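(* Let $\Phi=\xi+f$ with $\xi:\mathbb R^{n_x}\to\mathbb R\cup\{+\infty\}$ proper closed convex and $f:\mathbb R^{n_x}\to\mathbb R$ convex, differentiable on an open set containing $\operatorname{dom}\xi$ with Lipschitz gradient, let $g:\mathbb R^{n_y}\to\mathbb R\cup\{+\infty\}$ be proper closed convex with convex conjugate $g^*$, let $A\in\mathbb R^{n_y\times n_x}$, and let $c,\gamma>0$. Let $(x^k,y^k,\lambda^k)_{k\ge0}$ be generated by PG-ADMM applied to $\min_{x,y}\{\Phi(x)+g(y): Ax-y=\mathbf 0\}$, i.e., for $k\ge0$, $$x^{k+1}=\mathbf{prox}_{c\xi}\Big(x^k-c\big[\nabla f(x^k)+A^\top(\lambda^k+\gamma(Ax^k-y^k))\big]\Big),$$ $$y^{k+1}=\operatorname{argmin}_y\ g(y)+\tfrac\gamma2\|Ax^{k+1}-y+\gamma^{-1}\lambda^k\|^2,\qquad \lambda^{k+1}=\lambda^k+\gamma(Ax^{k+1}-y^{k+1}).$$ Set $\lambda^{-1}=\lambda^0-\gamma(Ax^0-y^0)$. Then for all $k\ge0$, $$x^{k+1}=\mathbf{prox}_{c\xi}\Big(x^k-c\big[\nabla f(x^k)+A^\top(2\lambda^k-\lambda^{k-1})\big]\Big),\qquad \lambda^{k+1}=\mathbf{prox}_{\gamma g^*}(\lambda^k+\gamma Ax^{k+1}),$$ i.e. PG-ADMM on this problem coincides with this primal-dual iteration.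
   Context: $\mathbf{prox}_{h}(x)=\operatorname{argmin}_z\{h(z)+\frac12\|z-x\|^2\}$ for a proper closed convex function $h$; $\|\cdot\|$ is the Euclidean norm. The initial point $x^0$ is one at which $\nabla f$ is defined. *)

theory Defs
  imports "HOL-Analysis.Analysis"
begin

definition dom_ext :: "('a \<Rightarrow> ereal) \<Rightarrow> 'a set" where
  "dom_ext h = {x. h x < \<infinity>}"

definition epi :: "('a \<Rightarrow> ereal) \<Rightarrow> ('a \<times> real) set" where
  "epi h = {(x, t). h x \<le> ereal t}"

definition proper_closed_convex :: "('a::euclidean_space \<Rightarrow> ereal) \<Rightarrow> bool" where
  "proper_closed_convex h \<longleftrightarrow>
     (\<forall>x. h x \<noteq> -\<infinity>) \<and> dom_ext h \<noteq> {} \<and> closed (epi h) \<and> convex (epi h)"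

definition convex_conjugate :: "('a::real_inner \<Rightarrow> ereal) \<Rightarrow> 'a \<Rightarrow> ereal" where
  "convex_conjugate h u = (SUP v. ereal (u \<bullet> v) - h v)"

text \<open>The library's \<open>arg_min\<close> returns some minimizer if there is one; for a proper closed
  convex \<open>h\<close> the strongly convex objective has exactly one, so no choice is involved.\<close>

definition argmin :: "('a \<Rightarrow> ereal) \<Rightarrow> 'a" where
  "argmin F = arg_min F (\<lambda>z. True)"

definition prox :: "('a::euclidean_space \<Rightarrow> ereal) \<Rightarrow> 'a \<Rightarrow> 'a" where
  "prox h x = argmin (\<lambda>z. h z + ereal (1/2 * (norm (z - x))\<^sup>2))"

text \<open>Meaningful only at points where \<open>f\<close> is differentiable.\<close>

definition grad :: "('a::euclidean_space \<Rightarrow> real) \<Rightarrow> 'a \<Rightarrow> 'a" where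
  "grad f x = (THE D. GDERIV f x :> D)"

end

theory Submission
  imports Defs
begin

text \<open>The optimality condition of the \<open>y\<close>-step says that the new multiplier is a subgradient of
  \<open>g\<close> at the new \<open>y\<close>. The Fenchel--Young equality turns this into a strong-convexity bound for the
  objective defining the proximal map of the conjugate, centred at the new multiplier (Moreau's
  decomposition). The \<open>x\<close>-step is the multiplier update solved for the residual.\<close>

section \<open>Minimizers selected by \<open>argmin\<close>\<close>

text \<open>\<open>arg_min\<close> is a choice operator and says nothing unless some minimizer
  exists; \<open>z\<close> is that witness.\<close>

lemma argmin_le:
  fixes F :: "'a \<Rightarrow> ereal"
  assumes "\<And>v. F z \<le> F v"
  shows "F (argmin F) \<le> F v"
proof -
  have "is_arg_min F (\<lambda>_. True) z"
    using assms by (auto simp: is_arg_min_def not_less)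
  then have "is_arg_min F (\<lambda>_. True) (argmin F)"
    unfolding argmin_def arg_min_def by (rule someI)
  then show ?thesis
    by (auto simp: is_arg_min_def not_less)
qed

lemma argmin_eqI:
  fixes F :: "'a \<Rightarrow> ereal"
  assumes "\<And>v. v \<noteq> z \<Longrightarrow> F z < F v"
  shows "argmin F = z"
proof (rule ccontr)
  assume "argmin F \<noteq> z"
  then have "F z < F (argmin F)" by (rule assms)
  moreover have "F (argmin F) \<le> F z"
    using assms by (intro argmin_le[of F z]) (metis order.refl order.strict_implies_order)
  ultimately show False by simp
qed

section \<open>Lower bounds for closed convex functions from their epigraphs\<close>

lemma convex_epiD:
  assumes "convex (epi h)" "h a \<le> ereal s" "h b \<le> ereal t" "0 \<le> r" "r \<le> 1"
  shows "h ((1 - r) *\<^sub>R a + r *\<^sub>R b) \<le> ereal ((1 - r) * s + r * t)"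
proof -
  have "(1 - r) *\<^sub>R (a, s) + r *\<^sub>R (b, t) \<in> epi h"
    using assms by (intro convexD) (auto simp: epi_def)
  then show ?thesis by (simp add: epi_def)
qed

lemma closed_sublevel_epi:
  fixes h :: "'a::euclidean_space \<Rightarrow> ereal"
  assumes "closed (epi h)"
  shows "closed {v. h v \<le> ereal t}"
proof -
  have "{v. h v \<le> ereal t} = (\<lambda>v. (v, t)) -` epi h"
    by (auto simp: epi_def)
  moreover have "closed ((\<lambda>v. (v, t)) -` epi h)"
    by (intro closed_vimage assms continuous_intros)
  ultimately show ?thesis by simp
qed

text \<open>Closed sublevel sets express lower semicontinuity. Were \<open>h\<close> unbounded below
  on \<open>K\<close>, the nested nonempty compact sets \<open>S n\<close> would share a point, and
  \<open>h\<close> would be \<open>-\<infinity>\<close> there.\<close>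

lemma bounded_below_on_compact:
  fixes h :: "'a::euclidean_space \<Rightarrow> ereal"
  assumes "closed (epi h)" "\<And>v. h v \<noteq> -\<infinity>" "compact K"
  shows "\<exists>m. \<forall>v\<in>K. ereal m \<le> h v"
proof (rule ccontr)
  assume neg: "\<not> ?thesis"
  define S where "S n = K \<inter> {v. h v \<le> ereal (- real n)}" for n
  have "compact (S n)" for n
    unfolding S_def by (intro compact_Int_closed assms closed_sublevel_epi)
  moreover have "S n \<noteq> {}" for n
  proof -
    obtain v where "v \<in> K" "h v < ereal (- real n)"
      using neg by (meson not_le)
    then show ?thesis by (auto simp: S_def intro: less_imp_le)
  qed
  moreover have "S n \<subseteq> S m" if "m \<le> n" for m n
    using that by (auto simp: S_def elim!: order_trans)
  ultimately have "\<Inter> (range S) \<noteq> {}"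
    by (rule compact_nest)
  then obtain v where v: "h v \<le> ereal (- real n)" for n
    by (auto simp: S_def)
  have "h v = -\<infinity>"
  proof (rule ereal_bot)
    fix B :: real
    obtain n where "- B \<le> real n" using real_arch_simple by blast
    then show "h v \<le> ereal B"
      by (intro order_trans[OF v[of n]]) simp
  qed
  with assms(2) show False by simp
qed

text \<open>A bound on the unit ball around a point of the domain spreads along rays by convexity; this
  avoids a separating hyperplane.\<close>

lemma linear_lower_bound:
  fixes h :: "'a::euclidean_space \<Rightarrow> ereal"
  assumes "proper_closed_convex h"
  shows "\<exists>a b. 0 \<le> b \<and> (\<forall>v. ereal (a - b * norm (v - w)) \<le> h v)"
proof -
  have h: "\<And>v. h v \<noteq> -\<infinity>" "closed (epi h)" "convex (epi h)"
    using assms by (auto simp: proper_closed_convex_def)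
  obtain x0 where "h x0 < \<infinity>"
    using assms by (auto simp: proper_closed_convex_def dom_ext_def)
  with h(1) obtain t0 where t0: "h x0 = ereal t0"
    by (cases "h x0") auto
  obtain m where m: "\<And>v. v \<in> cball x0 1 \<Longrightarrow> ereal m \<le> h v"
    using bounded_below_on_compact[OF h(2,1) compact_cball] by blast
  have "m \<le> t0" using m[of x0] t0 by simp
  have bound: "ereal (m - (t0 - m) * norm (v - x0)) \<le> h v" for v
  proof (cases "norm (v - x0) \<le> 1")
    case True
    then have "ereal m \<le> h v"
      by (intro m) (simp add: dist_norm norm_minus_commute)
    moreover have "m - (t0 - m) * norm (v - x0) \<le> m"
      using \<open>m \<le> t0\<close> by simp
    ultimately show ?thesis
      by (metis ereal_less_eq(3) order_trans)
  next
    case False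
    define r where "r = norm (v - x0)"
    have r: "r > 1" using False by (simp add: r_def)
    show ?thesis
    proof (cases "h v")
      case (real t)
      \<comment> \<open>The point where the segment from \<open>x0\<close> to \<open>v\<close>
        crosses the unit sphere around \<open>x0\<close>, so \<open>m\<close> bounds
        \<open>h\<close> there. By convexity \<open>h\<close> then falls by at most
        \<open>t0 - m\<close> per unit of length beyond it.\<close>
      let ?z = "(1 - 1/r) *\<^sub>R x0 + (1/r) *\<^sub>R v"
      have "?z - x0 = (1/r) *\<^sub>R (v - x0)" by (simp add: algebra_simps)
      then have "norm (?z - x0) = 1" using r by (auto simp: r_def)
      then have "ereal m \<le> h ?z"
        by (intro m) (simp add: dist_norm norm_minus_commute)
      also have "\<dots> \<le> ereal ((1 - 1/r) * t0 + (1/r) * t)"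
        using r real t0 by (intro convex_epiD h) auto
      finally have "m \<le> (1 - 1/r) * t0 + (1/r) * t" by simp
      then have "r * m \<le> r * ((1 - 1/r) * t0 + (1/r) * t)"
        using r by (intro mult_left_mono) auto
      also have "\<dots> = (r - 1) * t0 + t" using r by (simp add: field_simps)
      finally have "m - (t0 - m) * r \<le> t"
        using \<open>m \<le> t0\<close> by (simp add: algebra_simps)
      then show ?thesis using real by (simp add: r_def)
    qed (use h(1) in auto)
  qed
  \<comment> \<open>Moving the centre from \<open>x0\<close> to \<open>w\<close> costs only a
    constant, by the triangle inequality.\<close>
  have "ereal (m - (t0 - m) * norm (w - x0) - (t0 - m) * norm (v - w)) \<le> h v" for v
  proof -
    have "norm (v - x0) \<le> norm (w - x0) + norm (v - w)"
      using norm_triangle_ineq[of "w - x0" "v - w"] by simp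
    then have "(t0 - m) * norm (v - x0) \<le> (t0 - m) * (norm (w - x0) + norm (v - w))"
      using \<open>m \<le> t0\<close> by (intro mult_left_mono) auto
    then show ?thesis
      by (intro order_trans[OF _ bound]) (simp add: algebra_simps)
  qed
  then show ?thesis using \<open>m \<le> t0\<close> by (meson diff_ge_0_iff_ge)
qed

section \<open>Existence of proximal points\<close>

text \<open>Direct method: the quadratic outgrows the linear lower bound on \<open>h\<close>.
  Minimizing over points \<open>(v, t)\<close> of the epigraph replaces the extended-real, merely
  lower semicontinuous objective by the continuous real function \<open>G\<close>.\<close>

lemma exists_prox_minimizer:
  fixes h :: "'a::euclidean_space \<Rightarrow> ereal"
  assumes "proper_closed_convex h" "\<gamma> > 0"
  shows "\<exists>z. \<forall>v. h z + ereal (\<gamma> / 2 * (norm (w - z))\<^sup>2) \<le> h v + ereal (\<gamma> / 2 * (norm (w - v))\<^sup>2)"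
proof -
  have h: "\<And>v. h v \<noteq> -\<infinity>" "closed (epi h)"
    using assms by (auto simp: proper_closed_convex_def)
  obtain x0 where "h x0 < \<infinity>"
    using assms by (auto simp: proper_closed_convex_def dom_ext_def)
  with h(1) obtain t0 where t0: "h x0 = ereal t0"
    by (cases "h x0") auto
  obtain a b where b: "0 \<le> b" and ab: "\<And>v. ereal (a - b * norm (v - w)) \<le> h v"
    using linear_lower_bound[OF assms(1)] by blast
  define G where "G p = snd p + \<gamma> / 2 * (norm (w - fst p))\<^sup>2" for p :: "'a \<times> real"
  define M where "M = G (x0, t0)"
  define K where "K = epi h \<inter> {p. G p \<le> M}"
  have contG: "continuous_on T G" for T
    unfolding G_def by (intro continuous_intros)
  \<comment> \<open>At distance \<open>n\<close> beyond the first entry, the quadratic is at least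
    \<open>(b + 1) * n\<close>. Added to the lower bound \<open>a - b * n\<close>, it makes
    \<open>G\<close> at least \<open>a + n\<close>, and \<open>G p \<le> M\<close> then forces the
    second entry as a bound on \<open>n\<close>.\<close>
  define R where "R = max ((2 * b + 2) / \<gamma>) (M - a)"
  have "K \<subseteq> cball w R \<times> {a - b * R..M}"
  proof
    fix p assume "p \<in> K"
    obtain v t where p: "p = (v, t)" by (cases p)
    define n where "n = norm (v - w)"
    have n0: "0 \<le> n" by (simp add: n_def)
    have M: "t + \<gamma> / 2 * n\<^sup>2 \<le> M" and "h v \<le> ereal t"
      using \<open>p \<in> K\<close> by (auto simp: K_def G_def p epi_def n_def norm_minus_commute)
    with ab[of v] have t: "a - b * n \<le> t"
      by (metis ereal_less_eq(3) n_def order_trans)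
    have nR: "n \<le> R"
    proof (cases "n \<le> (2 * b + 2) / \<gamma>")
      case False
      then have "2 * b + 2 \<le> \<gamma> * n"
        using assms(2) by (simp add: field_simps)
      then have "(2 * b + 2) * n \<le> (\<gamma> * n) * n"
        using n0 by (rule mult_right_mono)
      then have "n \<le> M - a"
        using M t by (simp add: algebra_simps power2_eq_square)
      then show ?thesis by (simp add: R_def)
    qed (simp add: R_def)
    then have "b * n \<le> b * R" using b by (rule mult_left_mono)
    then have "a - b * R \<le> t" using t by simp
    moreover have "0 \<le> \<gamma> / 2 * n\<^sup>2" using assms(2) by simp
    then have "t \<le> M" using M by linarith
    ultimately show "p \<in> cball w R \<times> {a - b * R..M}"
      using nR by (simp add: p n_def dist_norm norm_minus_commute)
  qed
  moreover have "closed K"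
    unfolding K_def using contG[of UNIV] h(2)
    by (intro closed_Int closed_Collect_le continuous_intros) auto
  ultimately have "compact K"
    by (metis compact_Int_closed compact_Icc compact_Times compact_cball inf.absorb_iff2)
  moreover have "(x0, t0) \<in> K" by (simp add: K_def M_def epi_def t0)
  ultimately obtain q where q: "q \<in> K" "\<And>p. p \<in> K \<Longrightarrow> G q \<le> G p"
    using continuous_attains_inf[of K G] contG by blast
  have "h (fst q) + ereal (\<gamma> / 2 * (norm (w - fst q))\<^sup>2)
        \<le> h v + ereal (\<gamma> / 2 * (norm (w - v))\<^sup>2)" for v
  proof (cases "h v")
    case (real t)
    \<comment> \<open>Epigraph points outside \<open>K\<close> have \<open>G\<close> above
      \<open>M\<close>, hence above \<open>G q\<close>, so \<open>q\<close> is minimal over the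
      whole epigraph.\<close>
    have "G q \<le> G (v, t)"
      using q real by (cases "G (v, t) \<le> M") (auto simp: K_def epi_def)
    moreover have "h (fst q) \<le> ereal (snd q)"
      using q(1) by (auto simp: K_def epi_def)
    then have "h (fst q) + ereal (\<gamma> / 2 * (norm (w - fst q))\<^sup>2) \<le> ereal (G q)"
      unfolding G_def plus_ereal.simps(1)[symmetric] by (rule add_right_mono)
    ultimately show ?thesis
      using real by (auto simp: G_def elim!: order_trans)
  qed (use h(1) in auto)
  then show ?thesis by blast
qed

section \<open>Subgradients and the conjugate\<close>

text \<open>Compare \<open>z\<close> with points of the segment from \<open>z\<close> to
  \<open>v\<close>. The first-order change of the quadratic gives the slope
  \<open>\<gamma> *\<^sub>R (w - z)\<close>; its second-order term is still present after division
  by the step length \<open>r\<close>, but vanishes as \<open>r\<close> tends to 0.\<close>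

lemma minimizer_subgradient:
  fixes h :: "'a::euclidean_space \<Rightarrow> ereal"
  assumes "proper_closed_convex h" "\<gamma> > 0"
    and min: "\<And>v. h z + ereal (\<gamma> / 2 * (norm (w - z))\<^sup>2) \<le> h v + ereal (\<gamma> / 2 * (norm (w - v))\<^sup>2)"
  obtains s where "h z = ereal s"
    and "\<And>v. ereal (s + (\<gamma> *\<^sub>R (w - z)) \<bullet> (v - z)) \<le> h v"
proof -
  have h: "\<And>v. h v \<noteq> -\<infinity>" "convex (epi h)"
    using assms by (auto simp: proper_closed_convex_def)
  obtain x0 where "h x0 < \<infinity>"
    using assms by (auto simp: proper_closed_convex_def dom_ext_def)
  \<comment> \<open>The objective is finite at \<open>x0\<close>, so it is finite at the minimizer
    \<open>z\<close>.\<close>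
  with min[of x0] h(1)[of x0] h(1)[of z] obtain s where s: "h z = ereal s"
    by (cases "h z"; cases "h x0") auto
  have "ereal (s + (\<gamma> *\<^sub>R (w - z)) \<bullet> (v - z)) \<le> h v" for v
  proof (cases "h v")
    case (real t)
    define D where "D = \<gamma> / 2 * (norm (v - z))\<^sup>2"
    have key: "s + (\<gamma> *\<^sub>R (w - z)) \<bullet> (v - z) \<le> t + r * D" if r: "0 < r" "r < 1" for r
    proof -
      let ?p = "(1 - r) *\<^sub>R z + r *\<^sub>R v"
      have "h ?p \<le> ereal ((1 - r) * s + r * t)"
        using s real r by (intro convex_epiD h) auto
      then have "h ?p + ereal (\<gamma> / 2 * (norm (w - ?p))\<^sup>2)
          \<le> ereal ((1 - r) * s + r * t) + ereal (\<gamma> / 2 * (norm (w - ?p))\<^sup>2)"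
        by (rule add_right_mono)
      from order_trans[OF min this]
      have "s + \<gamma> / 2 * (norm (w - z))\<^sup>2
          \<le> (1 - r) * s + r * t + \<gamma> / 2 * (norm (w - ?p))\<^sup>2"
        by (simp add: s)
      moreover have "w - ?p = (w - z) - r *\<^sub>R (v - z)"
        by (simp add: algebra_simps)
      then have "(norm (w - ?p))\<^sup>2
          = (norm (w - z))\<^sup>2 - 2 * r * ((w - z) \<bullet> (v - z)) + r\<^sup>2 * (norm (v - z))\<^sup>2"
        by (simp only: power2_norm_eq_inner)
          (simp add: inner_diff_left[of "w - z"] inner_diff_right[of _ "w - z"]
            inner_commute[of "v - z" "w - z"] power2_eq_square right_diff_distrib)
      ultimately have "s + \<gamma> / 2 * (norm (w - z))\<^sup>2 \<le> (1 - r) * s + r * t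
          + \<gamma> / 2 * ((norm (w - z))\<^sup>2 - 2 * r * ((w - z) \<bullet> (v - z)) + r\<^sup>2 * (norm (v - z))\<^sup>2)"
        by simp
      then have "r * (s + (\<gamma> *\<^sub>R (w - z)) \<bullet> (v - z)) \<le> r * (t + r * D)"
        by (simp add: D_def algebra_simps power2_eq_square)
      then show ?thesis using r by simp
    qed
    have "((\<lambda>r. t + r * D) \<longlongrightarrow> t + 0 * D) (at_right 0)"
      by (intro tendsto_intros)
    moreover have "\<forall>\<^sub>F r in at_right 0. s + (\<gamma> *\<^sub>R (w - z)) \<bullet> (v - z) \<le> t + r * D"
      using key by (auto simp: eventually_at_right_field intro!: exI[of _ 1])
    ultimately have "s + (\<gamma> *\<^sub>R (w - z)) \<bullet> (v - z) \<le> t + 0 * D"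
      by (intro tendsto_lowerbound) auto
    then show ?thesis using real by simp
  qed (use h(1) in auto)
  with s show thesis by (rule that)
qed

lemma Fenchel_Young:
  assumes "h z = ereal s"
  shows "ereal (u \<bullet> z - s) \<le> convex_conjugate h u"
  unfolding convex_conjugate_def by (rule SUP_upper2[of z]) (simp_all add: assms)

text \<open>The equality case of Fenchel--Young: rearranged, the subgradient inequality says that
  \<open>v = z\<close> attains the supremum defining the conjugate at \<open>p\<close>.\<close>

lemma convex_conjugate_subgradient:
  assumes "h z = ereal s" and "\<And>v. ereal (s + p \<bullet> (v - z)) \<le> h v"
  shows "convex_conjugate h p = ereal (p \<bullet> z - s)"
proof (rule antisym)
  show "convex_conjugate h p \<le> ereal (p \<bullet> z - s)"
    unfolding convex_conjugate_def
  proof (rule SUP_least)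
    fix v
    show "ereal (p \<bullet> v) - h v \<le> ereal (p \<bullet> z - s)"
      using assms(2)[of v] by (cases "h v") (auto simp: inner_diff_right)
  qed
  show "ereal (p \<bullet> z - s) \<le> convex_conjugate h p"
    using assms(1) by (rule Fenchel_Young)
qed

section \<open>Moreau's decomposition and the equivalence of the iterations\<close>

lemma Moreau_decomposition:
  fixes h :: "'a::euclidean_space \<Rightarrow> ereal"
  assumes "proper_closed_convex h" "\<gamma> > 0"
  shows "prox (\<lambda>u. ereal \<gamma> * convex_conjugate h u) (\<gamma> *\<^sub>R w)
    = \<gamma> *\<^sub>R (w - argmin (\<lambda>v. h v + ereal (\<gamma> / 2 * (norm (w - v))\<^sup>2)))"
proof -
  define z where "z = argmin (\<lambda>v. h v + ereal (\<gamma> / 2 * (norm (w - v))\<^sup>2))"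
  define p where "p = \<gamma> *\<^sub>R (w - z)"
  obtain z' where z': "\<And>v. h z' + ereal (\<gamma> / 2 * (norm (w - z'))\<^sup>2)
      \<le> h v + ereal (\<gamma> / 2 * (norm (w - v))\<^sup>2)"
    using exists_prox_minimizer[OF assms] by blast
  have "h z + ereal (\<gamma> / 2 * (norm (w - z))\<^sup>2) \<le> h v + ereal (\<gamma> / 2 * (norm (w - v))\<^sup>2)" for v
    unfolding z_def
    using argmin_le[of "\<lambda>v. h v + ereal (\<gamma> / 2 * (norm (w - v))\<^sup>2)", OF z'] by simp
  then obtain s where s: "h z = ereal s" "\<And>v. ereal (s + p \<bullet> (v - z)) \<le> h v"
    unfolding p_def by (rule minimizer_subgradient[OF assms]) blast
  have "prox (\<lambda>u. ereal \<gamma> * convex_conjugate h u) (\<gamma> *\<^sub>R w) = p"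
    unfolding prox_def
  \<comment> \<open>The candidate \<open>p\<close> is explicit, so strict comparison with every
    other \<open>u\<close> yields existence and uniqueness of the dual minimizer at once.\<close>
  proof (rule argmin_eqI)
    fix u assume "u \<noteq> p"
    show "ereal \<gamma> * convex_conjugate h p + ereal (1/2 * (norm (p - \<gamma> *\<^sub>R w))\<^sup>2)
        < ereal \<gamma> * convex_conjugate h u + ereal (1/2 * (norm (u - \<gamma> *\<^sub>R w))\<^sup>2)"
    proof (cases "convex_conjugate h u")
      case (real q)
      have pw: "p - \<gamma> *\<^sub>R w = - (\<gamma> *\<^sub>R z)" by (simp add: p_def algebra_simps)
      define e where "e = (norm (u - p))\<^sup>2"
      have "u - \<gamma> *\<^sub>R w = (u - p) - \<gamma> *\<^sub>R z" by (simp add: p_def algebra_simps)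
      then have "(norm (u - \<gamma> *\<^sub>R w))\<^sup>2
          = e - 2 * \<gamma> * ((u - p) \<bullet> z) + (norm (\<gamma> *\<^sub>R z))\<^sup>2"
        by (simp only: e_def power2_norm_eq_inner)
          (simp add: inner_diff_left[of "u - p"] inner_diff_right[of _ "u - p"]
            inner_commute[of z "u - p"] right_diff_distrib)
      moreover have "0 < e" using \<open>u \<noteq> p\<close> by (simp add: e_def)
      moreover have "u \<bullet> z - s \<le> q"
        using Fenchel_Young[of h z s u] s(1) real by simp
      then have "\<gamma> * (u \<bullet> z - s) \<le> \<gamma> * q"
        using assms(2) by (intro mult_left_mono) auto
      \<comment> \<open>The term \<open>\<gamma> * ((u - p) \<bullet> z)\<close> gained from the
        conjugates cancels the cross term of the square, leaving a gap of at least
        \<open>e / 2\<close>.\<close>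
      ultimately have "\<gamma> * (p \<bullet> z - s) + 1/2 * (norm (p - \<gamma> *\<^sub>R w))\<^sup>2
          < \<gamma> * q + 1/2 * (norm (u - \<gamma> *\<^sub>R w))\<^sup>2"
        unfolding pw norm_minus_cancel by (simp add: inner_diff_left algebra_simps)
      then show ?thesis
        using convex_conjugate_subgradient[OF s] real by simp
    next
      case PInf
      then show ?thesis
        using convex_conjugate_subgradient[OF s] assms(2) by simp
    next
      \<comment> \<open>Impossible: \<open>h z\<close> is finite, so Fenchel--Young gives a finite
        lower bound at every \<open>u\<close>.\<close>
      case MInf
      then show ?thesis
        using Fenchel_Young[of h z s u] s(1) by simp
    qed
  qed
  then show ?thesis by (simp add: p_def z_def)
qed

theorem mainTheorem5:
  fixes \<xi> :: "real^'nx \<Rightarrow> ereal" and f :: "real^'nx \<Rightarrow> real" and g :: "real^'ny \<Rightarrow> ereal"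
    and A :: "real^'nx^'ny" and c \<gamma> L :: real and U :: "(real^'nx) set"
    and x :: "nat \<Rightarrow> real^'nx" and y lam :: "nat \<Rightarrow> real^'ny" and lam_init :: "real^'ny"
  assumes "proper_closed_convex \<xi>"
    and "convex_on UNIV f"
    and "open U" and "dom_ext \<xi> \<subseteq> U"
    and "\<forall>z\<in>U. f differentiable (at z)"
    and "L-lipschitz_on U (grad f)"
    and "proper_closed_convex g"
    and "c > 0" and "\<gamma> > 0"
    and "f differentiable (at (x 0))"
    and "\<forall>k. x (Suc k) = prox (\<lambda>z. ereal c * \<xi> z)
           (x k - c *\<^sub>R (grad f (x k) + transpose A *v (lam k + \<gamma> *\<^sub>R (A *v x k - y k))))"
    and "\<forall>k. y (Suc k) = argmin (\<lambda>v. g v +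
           ereal (\<gamma> / 2 * (norm (A *v x (Suc k) - v + inverse \<gamma> *\<^sub>R lam k))\<^sup>2))"
    and "\<forall>k. lam (Suc k) = lam k + \<gamma> *\<^sub>R (A *v x (Suc k) - y (Suc k))"
    and "lam_init = lam 0 - \<gamma> *\<^sub>R (A *v x 0 - y 0)" \<comment> \<open>the multiplier with index -1\<close>
  shows "\<forall>k. x (Suc k) = prox (\<lambda>z. ereal c * \<xi> z)
             (x k - c *\<^sub>R (grad f (x k) + transpose A *v
                (2 *\<^sub>R lam k - (case k of 0 \<Rightarrow> lam_init | Suc j \<Rightarrow> lam j))))
           \<and> lam (Suc k) = prox (\<lambda>u. ereal \<gamma> * convex_conjugate g u)
               (lam k + \<gamma> *\<^sub>R (A *v x (Suc k)))"
proof
  fix k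
  note step_x = assms(11) and step_y = assms(12) and step_lam = assms(13)
  \<comment> \<open>For \<open>k = 0\<close> this is the choice of \<open>lam_init\<close>, which
    extends the multiplier update one index back; for \<open>Suc j\<close> it is the update at step
    \<open>j\<close>.\<close>
  have "lam k - (case k of 0 \<Rightarrow> lam_init | Suc j \<Rightarrow> lam j) = \<gamma> *\<^sub>R (A *v x k - y k)"
    using step_lam assms(14) by (cases k) auto
  then have "lam k + \<gamma> *\<^sub>R (A *v x k - y k)
      = 2 *\<^sub>R lam k - (case k of 0 \<Rightarrow> lam_init | Suc j \<Rightarrow> lam j)"
    by (simp add: scaleR_2 algebra_simps)
  \<comment> \<open>Absorbing the scaled multiplier into \<open>w\<close> puts the
    \<open>y\<close>-step in Moreau form: \<open>\<gamma> *\<^sub>R w\<close> is the centre of the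
    dual prox, and \<open>\<gamma> *\<^sub>R (w - y (Suc k))\<close> is the new multiplier.\<close>
  moreover define w where "w = A *v x (Suc k) + inverse \<gamma> *\<^sub>R lam k"
  have "y (Suc k) = argmin (\<lambda>v. g v + ereal (\<gamma> / 2 * (norm (w - v))\<^sup>2))"
    using step_y by (simp add: w_def algebra_simps)
  moreover have "\<gamma> *\<^sub>R w = lam k + \<gamma> *\<^sub>R (A *v x (Suc k))"
    using \<open>\<gamma> > 0\<close> by (simp add: w_def scaleR_add_right add.commute)
  moreover from this have "lam (Suc k) = \<gamma> *\<^sub>R (w - y (Suc k))"
    using step_lam by (simp add: scaleR_diff_right)
  ultimately show "x (Suc k) = prox (\<lambda>z. ereal c * \<xi> z)
             (x k - c *\<^sub>R (grad f (x k) + transpose A *v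
                (2 *\<^sub>R lam k - (case k of 0 \<Rightarrow> lam_init | Suc j \<Rightarrow> lam j))))
           \<and> lam (Suc k) = prox (\<lambda>u. ereal \<gamma> * convex_conjugate g u)
               (lam k + \<gamma> *\<^sub>R (A *v x (Suc k)))"
    using step_x Moreau_decomposition[OF assms(7,9), of w] by metis
qed

end
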